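(* Assume $R_0=+\infty$ and let $\ell$, $K$ and $A$ be as described in the context (with $R_0=+\infty$). Then every function $u\in C_b^2(\mathbb{R}^d)$ satisfying $Au=0$ on $\mathbb{R}^d$ is a constant function.
   Context: $B_1$ denotes the open unit ball in $\mathbb{R}^d$ centered at $0$. $C_b^2(\mathbb{R}^d)$ is the set of functions $\mathbb{R}^d\to\mathbb{R}$ which, together with their first and second derivatives, are continuous and bounded. Here $R_0=+\infty$. Fixed constants: $\kappa\ge1$, $K_0\ge 1$, $c_L\in(0,1)$, $c_U\ge1$, $\gamma\in(0,2)$. The function $\ell:(0,\infty)\to(0,\infty)$ satisfies $\int_0^{\infty}\ell(s)\frac{ds}{s}=+\infty$ and - $\int_r^{\infty}\ell(s)\frac{ds}{s}<+\infty$ for all $r>0$; - $\frac{\ell(r\lambda)}{\ell(r)}\ge c_L\lambda^{-\gamma}$ for all $r>0$, $\lambda\ge1$; - $\frac{\ell(r\lambda)}{\ell(r)}\le c_U\lambda^{d}$ for all $r>0$, $\lambda\ge1$. The kernel $K:\mathbb{R}^d\times(\mathbb{R}^d\setminus\{0\})\to[0,+\infty)$ is measurable, $K(x,h)=K(x,-h)$ for all $x,h$, and - $\kappa^{-1}|h|^{-d}\ell(|h|)\le K(x,h)\le\kappa|h|^{-d}\ell(|h|)$ for all $x\in\mathbb{R}^d$ and $h\ne0$; - $\sup_{x\in\mathbb{R}^d}\int_{\mathbb{R}^d\setminus\{0\}}(1\wedge|h|^2)K(x,h)\,dh\le K_0$. The operator $A$ is defined for $u\in C_b^2(\mathbb{R}^d)$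 by $$Au(x)=\int_{\mathbb{R}^d\setminus\{0\}}\big(u(x+h)-u(x)-\langle\nabla u(x),h\rangle\mathbf{1}_{B_1}(h)\big)K(x,h)\,dh.$$ *)

theory Defs
  imports "HOL-Analysis.Analysis"
begin

definition grad :: "(real ^ 'd \<Rightarrow> real) \<Rightarrow> real ^ 'd \<Rightarrow> real ^ 'd" where
  "grad u x = (THE D. GDERIV u x :> D)"

(* g is the gradient of u and H its Hessian matrix.  Boundedness of the vector- and matrix-valued
   functions g and H is boundedness of all first and second partial derivatives. *)
definition Cb2 :: "(real ^ 'd \<Rightarrow> real) set" where
  "Cb2 = {u. continuous_on UNIV u \<and> bounded (range u) \<and>
     (\<exists>(g :: real ^ 'd \<Rightarrow> real ^ 'd) (H :: real ^ 'd \<Rightarrow> real ^ 'd ^ 'd).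
        (\<forall>x. GDERIV u x :> g x) \<and> continuous_on UNIV g \<and> bounded (range g) \<and>
        (\<forall>x. (g has_derivative (\<lambda>h. H x *v h)) (at x)) \<and>
        continuous_on UNIV H \<and> bounded (range H))}"

(* K x is only relevant off the origin.  For u in Cb2 and a kernel that is measurable with
   h \<mapsto> min 1 |h|^2 * K x h integrable, the integrand is absolutely integrable, so the
   convention that the Bochner integral of a non-integrable function is 0 plays no role. *)
definition nonlocal_op ::
  "(real ^ 'd \<Rightarrow> real ^ 'd \<Rightarrow> real) \<Rightarrow> (real ^ 'd \<Rightarrow> real) \<Rightarrow> real ^ 'd \<Rightarrow> real" where
  "nonlocal_op K u x =
     (LINT h:-{0}|lborel. (u (x + h) - u x - (grad u x \<bullet> h) * indicator (ball 0 1) h) * K x h)"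

end

(* Maximising u + 2 eps phi((. - x0)/R), phi(z) = 1/(1 + |z|^2), where u(x0) is within eps of sup u,
   yields a point x at which the second differences of u are at most
   4 eps min(1, |h|^2/R^2).  Since Au(x) = 0, the average of sup u - u(x + h) over |h| >= R with weight K
   is at most a multiple of eps times the integral of min(1, |h|^2/R^2) K, which the lower scaling of l
   (gamma < 2) bounds by the mass of K outside any fixed multiple of R.  The same holds for u - inf u
   around a point y near the infimum.  Choosing R >= |x0 - y0| makes the two weights comparable far
   out, so sup u - inf u is at most a constant, independent of R and eps, times eps. *)
theory Submission
  imports Defs
begin

text \<open>The extrema of \<open>u\<close> need not be attained, so the base points move with eps
  and their distance may grow without bound as eps tends to 0. The scale R has to follow, and the
  mass N of the kernel beyond 6R may then become arbitrarily small. Hence every error must be a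
  multiple of N with a factor independent of R; N is positive and cancels at the end. The bump suits
  this: its amplitude is of order eps whatever R is, and its cost min(1, |h|^2/R^2) integrates to a
  multiple of N because gamma < 2 keeps the second moment from concentrating at the origin. Scaling
  at all radii, i.e. R_0 = infinity, is what makes the factor uniform in R. Evenness of K turns A
  into an integral of second differences, so no gradient has to be controlled at the near-extremal
  points. Since K depends on x, the two equations carry different weights; both are compared with
  the single kernel K(0, .), at the price of powers of kappa.\<close>

section \<open>Affine substitution, and integrability against a kernel satisfying the Levy
  condition\<close>

lemma integrable_lborel_affine:
  fixes f :: "'a::euclidean_space \<Rightarrow> real"
  assumes [measurable]: "f \<in> borel_measurable borel" and c: "c \<noteq> 0"
  shows "integrable lborel (\<lambda>x. f (t + c *\<^sub>R x)) \<longleftrightarrow> integrable lborel f"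
proof -
  have "integrable lborel f \<longleftrightarrow>
      integrable (density (distr lborel borel (\<lambda>x. t + c *\<^sub>R x)) (\<lambda>_. \<bar>c\<bar> ^ DIM('a))) f"
    using lborel_affine[OF c, of t] by simp
  also have "\<dots> \<longleftrightarrow> integrable lborel (\<lambda>x. f (t + c *\<^sub>R x))"
    using c by (subst integrable_density) (auto simp: integrable_distr_eq)
  finally show ?thesis by simp
qed

lemma integral_lborel_affine:
  fixes f :: "'a::euclidean_space \<Rightarrow> real"
  assumes [measurable]: "f \<in> borel_measurable borel" and c: "c \<noteq> 0"
  shows "(\<integral>x. f x \<partial>lborel) = \<bar>c\<bar> ^ DIM('a) * (\<integral>x. f (t + c *\<^sub>R x) \<partial>lborel)"
proof -
  have "(\<integral>x. f x \<partial>lborel) =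
      (\<integral>x. f x \<partial>density (distr lborel borel (\<lambda>x. t + c *\<^sub>R x)) (\<lambda>_. \<bar>c\<bar> ^ DIM('a)))"
    using lborel_affine[OF c, of t] by simp
  also have "\<dots> = (\<integral>x. \<bar>c\<bar> ^ DIM('a) * f x \<partial>distr lborel borel (\<lambda>x. t + c *\<^sub>R x))"
    by (subst integral_density) auto
  also have "\<dots> = (\<integral>x. \<bar>c\<bar> ^ DIM('a) * f (t + c *\<^sub>R x) \<partial>lborel)"
    by (subst integral_distr) auto
  finally show ?thesis by simp
qed

lemma integrable_levy_bound:
  fixes k p :: "'a::euclidean_space \<Rightarrow> real"
  assumes "integrable lborel (\<lambda>h. min 1 ((norm h)\<^sup>2) * k h)"
    and [measurable]: "k \<in> borel_measurable borel" "p \<in> borel_measurable borel"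
    and "\<And>h. 0 \<le> k h" and B: "\<And>h. \<bar>p h\<bar> \<le> B * min 1 ((norm h)\<^sup>2)"
  shows "integrable lborel (\<lambda>h. p h * k h)"
proof (rule Bochner_Integration.integrable_bound)
  show "integrable lborel (\<lambda>h. B * (min 1 ((norm h)\<^sup>2) * k h))"
    using assms(1) by (rule integrable_mult_right)
  have "norm (p h * k h) \<le> norm (B * (min 1 ((norm h)\<^sup>2) * k h))" for h
  proof -
    have "norm (p h * k h) = \<bar>p h\<bar> * k h" using assms(4) by (simp add: abs_mult)
    also have "\<dots> \<le> (B * min 1 ((norm h)\<^sup>2)) * k h"
      using B assms(4) by (intro mult_right_mono) auto
    finally show ?thesis by (simp add: mult.assoc)
  qed
  then show "AE h in lborel. norm (p h * k h) \<le> norm (B * (min 1 ((norm h)\<^sup>2) * k h))"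
    by simp
qed measurable

text \<open>With \<open>c = 1/R\<close> this moves the truncation radius from R to 1, so that the
  Levy condition dominates truncations at any scale.\<close>

lemma min_one_square_le:
  fixes s c :: real
  assumes "0 \<le> s" "0 \<le> c"
  shows "min 1 ((c * s)\<^sup>2) \<le> max 1 (c\<^sup>2) * min 1 (s\<^sup>2)"
proof (cases "s \<le> 1")
  case True
  then have "s\<^sup>2 \<le> 1" using assms by (simp add: power_le_one)
  have "(c * s)\<^sup>2 \<le> max 1 (c\<^sup>2) * s\<^sup>2" by (simp add: power_mult_distrib mult_right_mono)
  then show ?thesis using \<open>s\<^sup>2 \<le> 1\<close> by (simp add: min_def)
next
  case False
  then have "s\<^sup>2 \<ge> 1" using one_le_power[of s 2] by auto
  then show ?thesis by simp
qed

lemma integrable_truncated_square: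
  fixes k :: "'a::euclidean_space \<Rightarrow> real"
  assumes "integrable lborel (\<lambda>h. min 1 ((norm h)\<^sup>2) * k h)"
    and "k \<in> borel_measurable borel" "\<And>h. 0 \<le> k h" "0 < R"
  shows "integrable lborel (\<lambda>h. min 1 ((norm h / R)\<^sup>2) * k h)"
proof (rule integrable_levy_bound[OF assms(1,2) _ assms(3), where B = "max 1 ((1/R)\<^sup>2)"])
  fix h :: 'a
  show "\<bar>min 1 ((norm h / R)\<^sup>2)\<bar> \<le> max 1 ((1/R)\<^sup>2) * min 1 ((norm h)\<^sup>2)"
    using min_one_square_le[of "norm h" "1/R"] \<open>0 < R\<close> by simp
qed measurable

lemma integrable_tail:
  fixes k p :: "'a::euclidean_space \<Rightarrow> real"
  assumes "integrable lborel (\<lambda>h. min 1 ((norm h)\<^sup>2) * k h)"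
    and "k \<in> borel_measurable borel" "\<And>h. 0 \<le> k h" "0 < R"
    and [measurable]: "p \<in> borel_measurable borel" and p: "\<And>h. \<bar>p h\<bar> \<le> B"
  shows "integrable lborel (\<lambda>h. indicator {h. R \<le> norm h} h * p h * k h)"
proof (rule integrable_levy_bound[OF assms(1,2) _ assms(3), where B = "B * max 1 ((1/R)\<^sup>2)"])
  fix h :: 'a
  have "0 \<le> B" using p[of h] by simp
  have "indicator {h. R \<le> norm h} h \<le> min 1 ((norm h / R)\<^sup>2)"
    using \<open>0 < R\<close> by (auto simp: indicator_def)
  also have "\<dots> \<le> max 1 ((1/R)\<^sup>2) * min 1 ((norm h)\<^sup>2)"
    using min_one_square_le[of "norm h" "1/R"] \<open>0 < R\<close> by simp
  finally have "\<bar>p h\<bar> * indicator {h. R \<le> norm h} h \<le> B * (max 1 ((1/R)\<^sup>2) * min 1 ((norm h)\<^sup>2))"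
    using p \<open>0 \<le> B\<close> by (intro mult_mono) auto
  then show "\<bar>indicator {h. R \<le> norm h} h * p h\<bar> \<le> B * max 1 ((1/R)\<^sup>2) * min 1 ((norm h)\<^sup>2)"
    by (simp add: abs_mult mult_ac)
qed measurable

lemma integrable_inner_square:
  fixes k :: "'a::euclidean_space \<Rightarrow> real"
  assumes "integrable lborel (\<lambda>h. min 1 ((norm h)\<^sup>2) * k h)"
    and "k \<in> borel_measurable borel" "\<And>h. 0 \<le> k h" "0 < R"
  shows "integrable lborel (\<lambda>h. indicator {h. norm h < R} h * (norm h)\<^sup>2 * k h)"
proof (rule integrable_levy_bound[OF assms(1,2) _ assms(3), where B = "max 1 (R\<^sup>2)"])
  fix h :: 'a
  show "\<bar>indicator {h. norm h < R} h * (norm h)\<^sup>2\<bar> \<le> max 1 (R\<^sup>2) * min 1 ((norm h)\<^sup>2)"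
  proof (cases "norm h \<le> 1")
    case True
    then have "(norm h)\<^sup>2 \<le> 1" by (simp add: power_le_one)
    moreover have "1 * (norm h)\<^sup>2 \<le> max 1 (R\<^sup>2) * (norm h)\<^sup>2" by (intro mult_right_mono) auto
    ultimately show ?thesis by (auto simp: indicator_def min_def)
  next
    case False
    then have "(norm h)\<^sup>2 \<ge> 1" using one_le_power[of "norm h" 2] by auto
    moreover have "norm h < R \<Longrightarrow> (norm h)\<^sup>2 \<le> R\<^sup>2" by (simp add: power_mono)
    ultimately show ?thesis by (auto simp: indicator_def)
  qed
qed measurable

section \<open>Second moment near the origin against tail mass\<close>

text \<open>Shrinking a ball by a factor q multiplies its second moment by at most D q^(gamma - 2),
  which is at most 1/2 for large q. So at least half of the second moment lies in the annulus R/q <=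
  |h| < R, and dilating that annulus by q places it in the tail at a bounded cost. No step depends
  on R, hence neither does \<open>C\<close>.\<close>

lemma truncated_moment_le_tail:
  fixes k :: "'a::euclidean_space \<Rightarrow> real" and D \<gamma> a :: real
  assumes int: "integrable lborel (\<lambda>h. min 1 ((norm h)\<^sup>2) * k h)"
    and meas[measurable]: "k \<in> borel_measurable borel" and nn: "\<And>h. 0 \<le> k h"
    and scale: "\<And>h t. 1 \<le> t \<Longrightarrow> k (inverse t *\<^sub>R h) \<le> D * t powr (real DIM('a) + \<gamma>) * k h"
    and D: "0 < D" and \<gamma>: "\<gamma> < 2" and a: "1 \<le> a"
  obtains C where "0 < C" "\<And>R. 0 < R \<Longrightarrow>
    (\<integral>h. min 1 ((norm h / R)\<^sup>2) * k h \<partial>lborel) \<le> C * (\<integral>h. indicator {h. a * R \<le> norm h} h * k h \<partial>lborel)"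
proof -
  \<comment> \<open>Chosen so that D q^(gamma - 2) <= 1/2; the maximum with 1 makes
    \<open>scale\<close> applicable with \<open>t = q\<close>.\<close>
  define q where "q = max 1 ((2 * D) powr (1 / (2 - \<gamma>)))"
  have q1: "1 \<le> q" by (simp add: q_def)
  have "2 * D = ((2 * D) powr (1 / (2 - \<gamma>))) powr (2 - \<gamma>)"
    using D \<gamma> by (simp add: powr_powr)
  also have "\<dots> \<le> q powr (2 - \<gamma>)" using \<gamma> by (intro powr_mono2) (auto simp: q_def)
  finally have qD: "2 * D \<le> q powr (2 - \<gamma>)" .
  define d where "d = DIM('a)"
  define I where "I R = (\<integral>h. indicator {h. norm h < R} h * (norm h)\<^sup>2 * k h \<partial>lborel)" for R
  define N where "N R = (\<integral>h. indicator {h. R \<le> norm h} h * k h \<partial>lborel)" for R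
  have intI: "integrable lborel (\<lambda>h. indicator {h. norm h < R} h * (norm h)\<^sup>2 * k h)" if "0 < R" for R
    by (rule integrable_inner_square[OF int meas nn that])
  have intN: "integrable lborel (\<lambda>h. indicator {h. R \<le> norm h} h * k h)" if "0 < R" for R
    using integrable_tail[OF int meas nn that, of "\<lambda>_. 1" 1] by simp
  \<comment> \<open>The Jacobian of the dilation absorbs the dimensional part of the scaling
    exponent, leaving only gamma.\<close>
  have cancel: "inverse q ^ d * q powr (real d + \<gamma>) = q powr \<gamma>"
    using q1 by (simp add: powr_add powr_realpow power_inverse)
  have I_shrink: "I (R / q) \<le> I R / 2" if "0 < R" for R
  proof -
    have "I (R / q) = inverse q ^ d * (\<integral>h. indicator {h. norm h < R/q} (inverse q *\<^sub>R h) *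
        (norm (inverse q *\<^sub>R h))\<^sup>2 * k (inverse q *\<^sub>R h) \<partial>lborel)"
      unfolding I_def d_def using q1 by (subst integral_lborel_affine[of _ "inverse q" 0]) auto
    also have "\<dots> \<le> inverse q ^ d * (\<integral>h. (inverse (q\<^sup>2) * D * q powr (real d + \<gamma>)) *
        (indicator {h. norm h < R} h * (norm h)\<^sup>2 * k h) \<partial>lborel)"
    proof (intro mult_left_mono integral_mono')
      show "integrable lborel (\<lambda>h. (inverse (q\<^sup>2) * D * q powr (real d + \<gamma>)) *
        (indicator {h. norm h < R} h * (norm h)\<^sup>2 * k h))"
        by (intro integrable_mult_right intI that)
      fix h :: 'a
      have eq: "inverse q *\<^sub>R h \<in> {h. norm h < R/q} \<longleftrightarrow> h \<in> {h. norm h < R}"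
        using q1 by (simp add: field_simps)
      have "indicator {h. norm h < R/q} (inverse q *\<^sub>R h) * (norm (inverse q *\<^sub>R h))\<^sup>2 * k (inverse q *\<^sub>R h)
        = indicator {h. norm h < R} h * (inverse (q\<^sup>2) * (norm h)\<^sup>2) * k (inverse q *\<^sub>R h)"
        using q1 eq by (simp add: indicator_def power_mult_distrib power_inverse)
      also have "\<dots> \<le> indicator {h. norm h < R} h * (inverse (q\<^sup>2) * (norm h)\<^sup>2) *
          (D * q powr (real DIM('a) + \<gamma>) * k h)"
        using scale[OF q1, of h] by (intro mult_left_mono) auto
      finally show "indicator {h. norm h < R/q} (inverse q *\<^sub>R h) * (norm (inverse q *\<^sub>R h))\<^sup>2 *
          k (inverse q *\<^sub>R h) \<le> (inverse (q\<^sup>2) * D * q powr (real d + \<gamma>)) *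
        (indicator {h. norm h < R} h * (norm h)\<^sup>2 * k h)"
        by (simp add: d_def mult_ac)
      show "0 \<le> (inverse (q\<^sup>2) * D * q powr (real d + \<gamma>)) *
        (indicator {h. norm h < R} h * (norm h)\<^sup>2 * k h)" using D nn by simp
    qed (use q1 in auto)
    also have "\<dots> = (inverse q ^ d * q powr (real d + \<gamma>)) * inverse (q\<^sup>2) * D * I R"
      unfolding I_def by (subst integral_mult_right_zero) (simp only: mult_ac)
    also have "\<dots> = D * q powr (\<gamma> - 2) * I R"
      unfolding cancel using q1 by (simp add: powr_diff powr_numeral field_simps)
    also have "\<dots> \<le> 1 / 2 * I R"
    proof (rule mult_right_mono)
      have "q powr (\<gamma> - 2) = inverse (q powr (2 - \<gamma>))"
        using powr_minus[of q "2 - \<gamma>"] by simp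
      moreover have "0 < q powr (2 - \<gamma>)" using q1 by simp
      ultimately show "D * q powr (\<gamma> - 2) \<le> 1 / 2"
        using qD by (simp add: pos_divide_le_eq flip: divide_inverse)
      show "0 \<le> I R" unfolding I_def using nn by (intro integral_nonneg_AE) auto
    qed
    finally show ?thesis by simp
  qed
  \<comment> \<open>The 2 comes from halving the moment, \<open>D * q powr \<gamma>\<close> from
    dilating the annulus into the tail.\<close>
  define E where "E = 2 * D * q powr \<gamma>"
  have E: "0 < E" using D q1 by (simp add: E_def)
  have I_le: "I R \<le> R\<^sup>2 * E * N R" if R: "0 < R" for R
  proof -
    let ?S = "{h::'a. R / q \<le> norm h \<and> norm h < R}"
    have Rq: "0 < R / q" "R / q \<le> R" using R q1 by (auto simp: field_simps)
    have intS: "integrable lborel (\<lambda>h. indicator ?S h * k h)"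
      by (rule Bochner_Integration.integrable_bound[OF intN[OF Rq(1)]])
        (auto simp: indicator_def)
    have "I R / 2 \<le> I R - I (R / q)" using I_shrink[OF R] by simp
    also have "\<dots> = (\<integral>h. indicator {h. norm h < R} h * (norm h)\<^sup>2 * k h -
        indicator {h. norm h < R/q} h * (norm h)\<^sup>2 * k h \<partial>lborel)"
      unfolding I_def by (rule Bochner_Integration.integral_diff[symmetric, OF intI[OF R] intI[OF Rq(1)]])
    also have "\<dots> \<le> (\<integral>h. R\<^sup>2 * (indicator ?S h * k h) \<partial>lborel)"
    proof (rule integral_mono')
      show "integrable lborel (\<lambda>h. R\<^sup>2 * (indicator ?S h * k h))"
        using intS by (rule integrable_mult_right)
      fix h :: 'a
      have "(norm h)\<^sup>2 * k h \<le> R\<^sup>2 * k h" if "norm h < R"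
        using that nn by (intro mult_right_mono power_mono) auto
      then show "indicator {h. norm h < R} h * (norm h)\<^sup>2 * k h -
        indicator {h. norm h < R/q} h * (norm h)\<^sup>2 * k h \<le> R\<^sup>2 * (indicator ?S h * k h)"
        using Rq by (auto simp: indicator_def)
      show "0 \<le> R\<^sup>2 * (indicator ?S h * k h)" using nn by simp
    qed
    also have "\<dots> = R\<^sup>2 * (\<integral>h. indicator ?S h * k h \<partial>lborel)" by simp
    \<comment> \<open>After the substitution the annulus becomes R <= |h| < qR, which lies inside
      the tail beyond R.\<close>
    also have "(\<integral>h. indicator ?S h * k h \<partial>lborel) =
        inverse q ^ d * (\<integral>h. indicator ?S (inverse q *\<^sub>R h) * k (inverse q *\<^sub>R h) \<partial>lborel)"
      unfolding d_def using q1 by (subst integral_lborel_affine[of _ "inverse q" 0]) auto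
    also have "\<dots> \<le> inverse q ^ d * (\<integral>h. D * q powr (real d + \<gamma>) * (indicator {h. R \<le> norm h} h * k h) \<partial>lborel)"
    proof (intro mult_left_mono integral_mono')
      show "integrable lborel (\<lambda>h. D * q powr (real d + \<gamma>) * (indicator {h. R \<le> norm h} h * k h))"
        by (intro integrable_mult_right intN R)
      fix h :: 'a
      have "indicator ?S (inverse q *\<^sub>R h) \<le> (indicator {h. R \<le> norm h} h :: real)"
        using q1 by (auto simp: indicator_def field_simps)
      then have "indicator ?S (inverse q *\<^sub>R h) * k (inverse q *\<^sub>R h) \<le>
          indicator {h. R \<le> norm h} h * (D * q powr (real DIM('a) + \<gamma>) * k h)"
        using scale[OF q1, of h] nn by (intro mult_mono) auto
      then show "indicator ?S (inverse q *\<^sub>R h) * k (inverse q *\<^sub>R h) \<le>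
          D * q powr (real d + \<gamma>) * (indicator {h. R \<le> norm h} h * k h)"
        by (simp add: d_def mult_ac)
      show "0 \<le> D * q powr (real d + \<gamma>) * (indicator {h. R \<le> norm h} h * k h)" using D nn by simp
    qed (use q1 in auto)
    also have "\<dots> = D * (inverse q ^ d * q powr (real d + \<gamma>)) * N R" unfolding N_def by (subst integral_mult_right_zero) (simp only: mult_ac)
    also have "\<dots> = D * q powr \<gamma> * N R" by (simp only: cancel)
    finally show ?thesis using R by (simp add: E_def algebra_simps)
  qed
  show ?thesis
  proof (rule that)
    show "0 < a\<^sup>2 * E + 1" using E by (simp add: add_nonneg_pos)
    fix R :: real assume R: "0 < R"
    then have aR: "0 < a * R" using a by simp
    \<comment> \<open>The split is made at radius aR instead of R, with the quadratic bound still
      used for R <= |h| < aR. This yields the tail beyond aR and costs the factor a^2.\<close>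
    have "(\<integral>h. min 1 ((norm h / R)\<^sup>2) * k h \<partial>lborel) \<le>
        (\<integral>h. inverse (R\<^sup>2) * (indicator {h. norm h < a*R} h * (norm h)\<^sup>2 * k h) +
          indicator {h. a * R \<le> norm h} h * k h \<partial>lborel)"
    proof (rule integral_mono')
      show "integrable lborel (\<lambda>h. inverse (R\<^sup>2) * (indicator {h. norm h < a*R} h * (norm h)\<^sup>2 * k h) +
          indicator {h. a * R \<le> norm h} h * k h)"
        by (intro Bochner_Integration.integrable_add integrable_mult_right intI intN aR)
      fix h :: 'a
      have "min 1 ((norm h / R)\<^sup>2) * k h \<le> (norm h / R)\<^sup>2 * k h" "min 1 ((norm h / R)\<^sup>2) * k h \<le> 1 * k h"
        using nn by (intro mult_right_mono; simp)+
      then show "min 1 ((norm h / R)\<^sup>2) * k h \<le>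
          inverse (R\<^sup>2) * (indicator {h. norm h < a*R} h * (norm h)\<^sup>2 * k h) +
          indicator {h. a * R \<le> norm h} h * k h"
        by (auto simp: indicator_def power_divide field_simps)
      show "0 \<le> inverse (R\<^sup>2) * (indicator {h. norm h < a*R} h * (norm h)\<^sup>2 * k h) +
          indicator {h. a * R \<le> norm h} h * k h" using nn by simp
    qed
    also have "\<dots> = inverse (R\<^sup>2) * I (a * R) + N (a * R)"
      unfolding I_def N_def
      by (subst Bochner_Integration.integral_add)
        (auto intro!: Bochner_Integration.integrable_add integrable_mult_right intI intN aR)
    also have "\<dots> \<le> inverse (R\<^sup>2) * ((a * R)\<^sup>2 * E * N (a * R)) + N (a * R)"
      using I_le[OF aR] by (intro add_mono mult_left_mono) auto
    also have "\<dots> = (a\<^sup>2 * E + 1) * N (a * R)"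
      using R by (simp add: power_mult_distrib field_simps)
    finally show "(\<integral>h. min 1 ((norm h / R)\<^sup>2) * k h \<partial>lborel) \<le>
      (a\<^sup>2 * E + 1) * (\<integral>h. indicator {h. a * R \<le> norm h} h * k h \<partial>lborel)"
      unfolding N_def .
  qed
qed

section \<open>Near-maximum points and the deviation from the supremum far away\<close>

text \<open>By the parallelogram law the two denominators sum to 2(s + b), and convexity of 1/t
  gives 1/p + 1/q >= 2/(s + b). This differs from 2/s by at most 2b since s >= 1. The alternative
  bound by 2 holds because the bump has values in (0, 1].\<close>

lemma second_difference_bump:
  fixes z v :: "'a::real_inner"
  shows "2 / (1 + (norm z)\<^sup>2) - 2 * min 1 ((norm v)\<^sup>2) \<le>
    1 / (1 + (norm (z + v))\<^sup>2) + 1 / (1 + (norm (z - v))\<^sup>2)"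
proof -
  define p q s b where "p = 1 + (norm (z + v))\<^sup>2" and "q = 1 + (norm (z - v))\<^sup>2"
    and "s = 1 + (norm z)\<^sup>2" and "b = (norm v)\<^sup>2"
  have pos: "0 < p" "0 < q" "1 \<le> s" "0 \<le> b"
    by (simp_all add: p_def q_def s_def b_def add_pos_nonneg)
  have sum: "p + q = 2 * (s + b)"
    by (simp add: p_def q_def s_def b_def power2_norm_eq_inner algebra_simps inner_commute)
  have "4 * (p * q) \<le> (p + q) * (p + q)"
    using sum_squares_ge_zero[of "p - q" 0] by (simp add: algebra_simps)
  then have "4 / (p + q) \<le> 1 / p + 1 / q"
    using pos by (simp add: field_simps)
  moreover have "2 / s - 2 * b \<le> 4 / (p + q)"
  proof -
    have "2 / s - 2 / (s + b) = 2 * b / (s * (s + b))"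
      using pos by (simp add: field_simps)
    also have "\<dots> \<le> 2 * b / 1"
      using pos mult_mono[of 1 s 1 "s + b"] by (intro divide_left_mono) auto
    finally have "2 / s - 2 * b \<le> 2 / (s + b)" by simp
    also have "\<dots> = 4 / (p + q)" unfolding sum using pos by (simp add: divide_simps)
    finally show ?thesis .
  qed
  moreover have "2 / s \<le> 2" "0 \<le> 1 / p" "0 \<le> 1 / q" using pos by (simp_all add: field_simps)
  ultimately have "2 / s - 2 * b \<le> 1 / p + 1 / q" "2 / s - 2 \<le> 1 / p + 1 / q" by linarith+
  then show ?thesis
    unfolding p_def[symmetric] q_def[symmetric] s_def[symmetric] b_def[symmetric]
    by (simp add: min_def)
qed

text \<open>The weight 2 eps makes the perturbed function exceed M + eps at \<open>x0\<close>, while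
  outside the ball of radius R the bump is at most 1/2 and the perturbed function at most M + eps. A
  maximum over the compact ball is therefore global, and its second differences are nonpositive;
  those of \<open>u\<close> are then controlled by those of the bump.\<close>

lemma near_maximum_point:
  fixes u :: "'a::euclidean_space \<Rightarrow> real"
  assumes cont: "continuous_on UNIV u" and ub: "\<And>z. u z \<le> M"
    and x0: "M - \<epsilon> < u x0" and \<epsilon>: "0 < \<epsilon>" and R: "0 < R"
  obtains x where "norm (x - x0) \<le> R" "M - \<epsilon> \<le> u x"
    "\<And>h. u (x + h) + u (x - h) - 2 * u x \<le> 4 * \<epsilon> * min 1 ((norm h / R)\<^sup>2)"
proof -
  define \<phi> where "\<phi> z = 1 / (1 + (norm ((z - x0) /\<^sub>R R))\<^sup>2)" for z
  define w where "w z = u z + 2 * \<epsilon> * \<phi> z" for z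
  have nz: "1 + (norm ((z - x0) /\<^sub>R R))\<^sup>2 \<noteq> 0" for z
    by (metis add_pos_nonneg less_irrefl zero_le_power2 zero_less_one)
  have "continuous_on UNIV w"
    unfolding w_def \<phi>_def by (intro continuous_intros cont) (use nz in auto)
  then have "continuous_on (cball x0 R) w" by (rule continuous_on_subset) simp
  then obtain x where x: "x \<in> cball x0 R" and max: "\<And>z. z \<in> cball x0 R \<Longrightarrow> w z \<le> w x"
    using continuous_attains_sup[of "cball x0 R" w] R by auto
  have w0: "M + \<epsilon> < w x0" using x0 by (simp add: w_def \<phi>_def)
  have le: "w z \<le> w x" for z
  proof (cases "z \<in> cball x0 R")
    case False
    then have "1 \<le> norm ((z - x0) /\<^sub>R R)" 
      using R unfolding norm_scaleR by (simp add: dist_norm norm_minus_commute divide_simps)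
    then have "1 \<le> (norm ((z - x0) /\<^sub>R R))\<^sup>2" by (rule one_le_power)
    then have "\<phi> z \<le> 1 / 2" unfolding \<phi>_def by (intro divide_left_mono) auto
    then have "\<epsilon> * \<phi> z \<le> \<epsilon> * (1 / 2)" using \<epsilon> by (intro mult_left_mono) auto
    then have "w z \<le> M + \<epsilon>" unfolding w_def using ub[of z] by linarith
    also have "\<dots> \<le> w x" using w0 max[of x0] R by simp
    finally show ?thesis .
  qed (rule max)
  \<comment> \<open>The bump contributes at most 2 eps to w(x) > M + eps, which leaves u(x) >= M -
    eps.\<close>
  have "\<phi> x \<le> 1" by (simp add: \<phi>_def field_simps add_pos_nonneg)
  then have "\<epsilon> * \<phi> x \<le> \<epsilon>" using \<epsilon> by simp
  then have "M - \<epsilon> \<le> u x" using w0 le[of x0] unfolding w_def by linarith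
  moreover have "u (x + h) + u (x - h) - 2 * u x \<le> 4 * \<epsilon> * min 1 ((norm h / R)\<^sup>2)" for h
  proof -
    have "2 * \<phi> x - 2 * min 1 ((norm h / R)\<^sup>2) \<le> \<phi> (x + h) + \<phi> (x - h)"
      using second_difference_bump[of "(x - x0) /\<^sub>R R" "h /\<^sub>R R"] R
      by (simp add: \<phi>_def algebra_simps divide_inverse)
    then have "2 * \<epsilon> * (2 * \<phi> x - 2 * min 1 ((norm h / R)\<^sup>2)) \<le> 2 * \<epsilon> * (\<phi> (x + h) + \<phi> (x - h))"
      using \<epsilon> by (intro mult_left_mono) auto
    moreover have "w (x + h) + w (x - h) \<le> 2 * w x" using le[of "x + h"] le[of "x - h"] by simp
    ultimately show ?thesis unfolding w_def by (simp add: algebra_simps)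
  qed
  ultimately show ?thesis using x that by (simp add: dist_norm norm_minus_commute)
qed

text \<open>Subtracting the second difference, whose integral vanishes, from its upper bound leaves
  a nonnegative integrand that dominates M - u(x + h) for |h| >= R. The equation holds for
  \<open>k'\<close>, the conclusion is stated for \<open>k\<close>: passing from one to the other
  and back costs \<open>c\<close> each time, hence \<open>c\<^sup>2\<close>.\<close>

lemma tail_deviation_le:
  fixes u k k' :: "'a::euclidean_space \<Rightarrow> real"
  assumes int: "integrable lborel (\<lambda>h. min 1 ((norm h)\<^sup>2) * k h)"
    and meas: "k \<in> borel_measurable borel" and nn: "\<And>h. 0 \<le> k h"
    and int': "integrable lborel (\<lambda>h. min 1 ((norm h)\<^sup>2) * k' h)"
    and meas': "k' \<in> borel_measurable borel" and nn': "\<And>h. 0 \<le> k' h"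
    and cmp: "\<And>h. k h \<le> c * k' h" "\<And>h. k' h \<le> c * k h" and c: "0 < c"
    and um[measurable]: "u \<in> borel_measurable borel" and B: "\<And>z. \<bar>u z\<bar> \<le> B"
    and ub: "\<And>z. u z \<le> M" and ux: "M - \<epsilon> \<le> u x" and R: "0 < R" and \<epsilon>: "0 < \<epsilon>"
    and second: "\<And>h. u (x + h) + u (x - h) - 2 * u x \<le> 4 * \<epsilon> * min 1 ((norm h / R)\<^sup>2)"
    and intD: "integrable lborel (\<lambda>h. (u (x + h) + u (x - h) - 2 * u x) * k' h)"
    and zero: "(\<integral>h. (u (x + h) + u (x - h) - 2 * u x) * k' h \<partial>lborel) = 0"
  shows "(\<integral>h. indicator {h. R \<le> norm h} h * (M - u (x + h)) * k h \<partial>lborel) \<le>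
    4 * \<epsilon> * c\<^sup>2 * (\<integral>h. min 1 ((norm h / R)\<^sup>2) * k h \<partial>lborel)"
proof -
  have intJ: "integrable lborel (\<lambda>h. min 1 ((norm h / R)\<^sup>2) * k h)"
    by (rule integrable_truncated_square[OF int meas nn R])
  have intJ': "integrable lborel (\<lambda>h. min 1 ((norm h / R)\<^sup>2) * k' h)"
    by (rule integrable_truncated_square[OF int' meas' nn' R])
  have intT': "integrable lborel (\<lambda>h. indicator {h. R \<le> norm h} h * (M - u (x + h)) * k' h)"
  proof (rule integrable_tail[OF int' meas' nn' R])
    show "\<bar>M - u (x + h)\<bar> \<le> \<bar>M\<bar> + B" for h using B[of "x + h"] by linarith
  qed measurable
  have "(\<integral>h. indicator {h. R \<le> norm h} h * (M - u (x + h)) * k h \<partial>lborel) \<le>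
      (\<integral>h. c * (indicator {h. R \<le> norm h} h * (M - u (x + h)) * k' h) \<partial>lborel)"
  proof (rule integral_mono')
    fix h
    show "indicator {h. R \<le> norm h} h * (M - u (x + h)) * k h \<le>
        c * (indicator {h. R \<le> norm h} h * (M - u (x + h)) * k' h)"
      using cmp(1)[of h] ub[of "x + h"] mult_left_mono[of "k h" "c * k' h" "M - u (x + h)"]
      by (auto simp: indicator_def mult_ac)
    show "0 \<le> c * (indicator {h. R \<le> norm h} h * (M - u (x + h)) * k' h)"
      using c ub[of "x + h"] nn' by simp
  qed (intro integrable_mult_right intT')
  also have "\<dots> = c * (\<integral>h. indicator {h. R \<le> norm h} h * (M - u (x + h)) * k' h \<partial>lborel)"
    by simp
  also have "(\<integral>h. indicator {h. R \<le> norm h} h * (M - u (x + h)) * k' h \<partial>lborel) \<le>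
      (\<integral>h. 4 * \<epsilon> * (min 1 ((norm h / R)\<^sup>2) * k' h) - (u (x + h) + u (x - h) - 2 * u x) * k' h \<partial>lborel)"
  proof (rule integral_mono)
    fix h
    have "indicator {h. R \<le> norm h} h * (M - u (x + h)) \<le>
        4 * \<epsilon> * min 1 ((norm h / R)\<^sup>2) - (u (x + h) + u (x - h) - 2 * u x)"
    proof (cases "R \<le> norm h")
      case True
      then have "1 \<le> (norm h / R)\<^sup>2" using R by (intro one_le_power) simp
      then have "min 1 ((norm h / R)\<^sup>2) = 1" by simp
      \<comment> \<open>From u(x) >= M - eps and u(x - h) <= M the right side is at least M - u(x +
        h) + 2 eps.\<close>
      then show ?thesis using True ux ub[of "x - h"] \<epsilon> by simp
    next
      case False
      then show ?thesis using second[of h] by simp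
    qed
    from mult_right_mono[OF this nn'[of h]]
    show "indicator {h. R \<le> norm h} h * (M - u (x + h)) * k' h \<le>
        4 * \<epsilon> * (min 1 ((norm h / R)\<^sup>2) * k' h) - (u (x + h) + u (x - h) - 2 * u x) * k' h"
      by (simp only: left_diff_distrib mult.assoc)
  qed (intro intT' Bochner_Integration.integrable_diff integrable_mult_right intJ' intD)+
  also have "\<dots> = 4 * \<epsilon> * (\<integral>h. min 1 ((norm h / R)\<^sup>2) * k' h \<partial>lborel)"
    using zero by (subst Bochner_Integration.integral_diff[OF integrable_mult_right[OF intJ'] intD]) simp
  also have "(\<integral>h. min 1 ((norm h / R)\<^sup>2) * k' h \<partial>lborel) \<le>
      (\<integral>h. c * (min 1 ((norm h / R)\<^sup>2) * k h) \<partial>lborel)"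
  proof (rule integral_mono')
    fix h
    show "min 1 ((norm h / R)\<^sup>2) * k' h \<le> c * (min 1 ((norm h / R)\<^sup>2) * k h)"
      using mult_left_mono[OF cmp(2)[of h], of "min 1 ((norm h / R)\<^sup>2)"] by (simp add: mult_ac)
    show "0 \<le> c * (min 1 ((norm h / R)\<^sup>2) * k h)" using c nn by simp
  qed (intro integrable_mult_right intJ)
  also have "\<dots> = c * (\<integral>h. min 1 ((norm h / R)\<^sup>2) * k h \<partial>lborel)" by simp
  finally show ?thesis using c \<epsilon> by (simp add: power2_eq_square mult_ac)
qed

section \<open>Taylor bound on \<open>Cb2\<close> and symmetrisation of the operator\<close>

lemma norm_matrix_vector_mult_le:
  fixes A :: "real ^ 'n ^ 'm"
  shows "norm (A *v h) \<le> norm A * norm h"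
proof -
  have "norm (A *v h) = L2_set (\<lambda>i. \<bar>A $ i \<bullet> h\<bar>) UNIV"
    by (simp add: norm_vec_def matrix_vector_mult_def inner_vec_def)
  also have "\<dots> \<le> L2_set (\<lambda>i. norm (A $ i) * norm h) UNIV"
    by (intro L2_set_mono Cauchy_Schwarz_ineq2) auto
  also have "\<dots> = norm A * norm h"
    by (simp add: norm_vec_def[of A] L2_set_left_distrib)
  finally show ?thesis .
qed

lemma grad_eq:
  assumes "GDERIV u x :> D"
  shows "grad u x = D"
  unfolding grad_def
proof (rule the_equality, rule assms)
  fix D' assume "GDERIV u x :> D'"
  then have "(\<lambda>h. h \<bullet> D') = (\<lambda>h. h \<bullet> D)"
    using assms unfolding gderiv_def by (rule has_derivative_unique)
  then have "h \<bullet> D' = h \<bullet> D" for h by meson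
  then show "D' = D" by (metis vector_eq_ldot)
qed

text \<open>The bounded Hessian makes the gradient Lipschitz, and a second use of the mean value
  inequality gives the quadratic remainder. The sharp factor 1/2 is given up; one constant serves
  both bounds.\<close>

lemma Cb2_taylor:
  fixes u :: "real ^ 'd \<Rightarrow> real"
  assumes "u \<in> Cb2"
  obtains B where "0 \<le> B" "\<And>x. \<bar>u x\<bar> \<le> B"
    "\<And>x h. \<bar>u (x + h) - u x - grad u x \<bullet> h\<bar> \<le> B * (norm h)\<^sup>2"
proof -
  from assms obtain g H where bu: "bounded (range u)"
    and g: "\<And>x. GDERIV u x :> g x" and H: "\<And>x. (g has_derivative (\<lambda>h. H x *v h)) (at x)"
    and bH: "bounded (range H)"
    unfolding Cb2_def by auto
  from bu obtain B1 where B1: "\<And>x. \<bar>u x\<bar> \<le> B1" unfolding bounded_iff by auto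
  from bH obtain B2 where B2: "\<And>x. norm (H x) \<le> B2" unfolding bounded_iff by auto
  have B2_nn: "0 \<le> B2" using B2[of 0] norm_ge_zero order_trans by blast
  have lip: "norm (g y - g x) \<le> B2 * norm (y - x)" for x y
  proof (rule differentiable_bound[of UNIV g "\<lambda>x h. H x *v h"])
    show "onorm ((*v) (H z)) \<le> B2" for z
    proof (rule onorm_le)
      show "norm (H z *v h) \<le> B2 * norm h" for h
        using norm_matrix_vector_mult_le[of "H z" h] mult_right_mono[OF B2[of z], of "norm h"] by simp
    qed
  qed (use H in auto)
  have taylor: "\<bar>u (x + h) - u x - g x \<bullet> h\<bar> \<le> B2 * (norm h)\<^sup>2" for x h
  proof -
    have "norm (u (x + h) - u x - (\<lambda>v. v \<bullet> g x) (x + h - x)) \<le> norm (x + h - x) * (B2 * norm h)"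
    proof (rule differentiable_bound_linearization[of x "x + h" "cball x (norm h)" u "\<lambda>z v. v \<bullet> g z"])
      fix t :: real assume "t \<in> {0..1}"
      then have "\<bar>t\<bar> * norm h \<le> norm h" by (intro mult_left_le_one_le) auto
      then show "x + t *\<^sub>R (x + h - x) \<in> cball x (norm h)" by (simp add: dist_norm)
    next
      fix z assume z: "z \<in> cball x (norm h)"
      show "(u has_derivative (\<lambda>v. v \<bullet> g z)) (at z within cball x (norm h))"
        using g[of z] unfolding gderiv_def by (rule has_derivative_at_withinI)
      show "onorm ((\<lambda>v. v \<bullet> g z) - (\<lambda>v. v \<bullet> g x)) \<le> B2 * norm h"
      proof (rule onorm_le)
        fix v
        have "norm (((\<lambda>v. v \<bullet> g z) - (\<lambda>v. v \<bullet> g x)) v) = \<bar>v \<bullet> (g z - g x)\<bar>"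
          by (simp add: inner_diff_right)
        also have "\<dots> \<le> norm v * norm (g z - g x)" by (rule Cauchy_Schwarz_ineq2)
        also have "\<dots> \<le> norm v * (B2 * norm (z - x))" by (intro mult_left_mono lip) auto
        also have "\<dots> \<le> norm v * (B2 * norm h)"
          using z B2_nn by (intro mult_left_mono) (auto simp: dist_norm norm_minus_commute)
        finally show "norm (((\<lambda>v. v \<bullet> g z) - (\<lambda>v. v \<bullet> g x)) v) \<le> B2 * norm h * norm v"
          by (simp add: mult_ac)
      qed
    qed simp
    then show ?thesis by (simp add: inner_commute power2_eq_square mult_ac)
  qed
  show ?thesis
  proof (rule that[of "max B1 B2"])
    show "0 \<le> max B1 B2" using B2_nn by simp
    show "\<bar>u x\<bar> \<le> max B1 B2" for x using B1[of x] by simp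
    fix x h :: "real ^ 'd"
    have "B2 * (norm h)\<^sup>2 \<le> max B1 B2 * (norm h)\<^sup>2" by (intro mult_right_mono) auto
    then show "\<bar>u (x + h) - u x - grad u x \<bullet> h\<bar> \<le> max B1 B2 * (norm h)\<^sup>2"
      using taylor[of x h] grad_eq[OF g[of x]] by simp
  qed
qed

text \<open>Reflection in the origin preserves the even kernel. Adding the integrand at h and -h
  cancels the odd gradient term, and the two equal integrals account for the factor 2. The indicator
  in \<open>k\<close> turns the integral off the origin into one over the whole space.\<close>

lemma nonlocal_op_second_difference:
  fixes u :: "real ^ 'd \<Rightarrow> real" and K :: "real ^ 'd \<Rightarrow> real ^ 'd \<Rightarrow> real" and x :: "real ^ 'd"
  defines "k \<equiv> \<lambda>h. indicator (- {0}) h * K x h"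
  assumes u: "u \<in> Cb2" and int: "integrable lborel (\<lambda>h. min 1 ((norm h)\<^sup>2) * k h)"
    and meas[measurable]: "k \<in> borel_measurable borel" and nn: "\<And>h. 0 \<le> k h"
    and sym: "\<And>h. k (- h) = k h"
  shows "integrable lborel (\<lambda>h. (u (x + h) + u (x - h) - 2 * u x) * k h)"
    and "(\<integral>h. (u (x + h) + u (x - h) - 2 * u x) * k h \<partial>lborel) = 2 * nonlocal_op K u x"
proof -
  have [measurable]: "u \<in> borel_measurable borel"
    using u by (intro borel_measurable_continuous_onI) (simp add: Cb2_def)
  obtain B where B: "0 \<le> B" "\<And>x. \<bar>u x\<bar> \<le> B"
    "\<And>x h. \<bar>u (x + h) - u x - grad u x \<bullet> h\<bar> \<le> B * (norm h)\<^sup>2"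
    using Cb2_taylor[OF u] by blast
  define f where "f h = u (x + h) - u x - (grad u x \<bullet> h) * indicator {h. norm h < 1} h" for h
  have [measurable]: "f \<in> borel_measurable borel" unfolding f_def by measurable
  have intf: "integrable lborel (\<lambda>h. f h * k h)"
  proof (rule integrable_levy_bound[OF int meas _ nn])
    fix h
    show "\<bar>f h\<bar> \<le> 2 * B * min 1 ((norm h)\<^sup>2)"
    proof (cases "norm h < 1")
      case True
      then have "(norm h)\<^sup>2 \<le> 1" by (simp add: power_le_one)
      moreover have "B * (norm h)\<^sup>2 \<le> 2 * (B * (norm h)\<^sup>2)" using B(1) by simp
      ultimately show ?thesis using True B(3)[of x h] by (simp add: f_def min_def mult.assoc)
    next
      case False
      then have "1 \<le> (norm h)\<^sup>2" by (intro one_le_power) simp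
      then show ?thesis using False B(2)[of x] B(2)[of "x + h"] by (simp add: f_def min_def)
    qed
  qed measurable
  have intf': "integrable lborel (\<lambda>h. f (- h) * k h)"
    using integrable_lborel_affine[of "\<lambda>h. f h * k h" "- 1" 0] intf sym by simp
  have refl: "(\<integral>h. f (- h) * k h \<partial>lborel) = (\<integral>h. f h * k h \<partial>lborel)"
    using integral_lborel_affine[of "\<lambda>h. f h * k h" "- 1" 0] sym by simp
  have eq: "(u (x + h) + u (x - h) - 2 * u x) * k h = f h * k h + f (- h) * k h" for h
    by (simp add: f_def indicator_def algebra_simps)
  show "integrable lborel (\<lambda>h. (u (x + h) + u (x - h) - 2 * u x) * k h)"
    unfolding eq by (intro Bochner_Integration.integrable_add intf intf')
  have "nonlocal_op K u x = (\<integral>h. f h * k h \<partial>lborel)"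
    unfolding nonlocal_op_def set_lebesgue_integral_def f_def k_def
    by (intro Bochner_Integration.integral_cong) (auto simp: indicator_def)
  then show "(\<integral>h. (u (x + h) + u (x - h) - 2 * u x) * k h \<partial>lborel) = 2 * nonlocal_op K u x"
    unfolding eq using refl by (subst Bochner_Integration.integral_add[OF intf intf']) simp
qed

section \<open>The oscillation estimate, relative to one reference kernel\<close>

lemma liouville_comparable_kernels:
  fixes u k :: "'a::euclidean_space \<Rightarrow> real" and kx :: "'a \<Rightarrow> 'a \<Rightarrow> real" and D E \<gamma> c B :: real
  assumes int: "integrable lborel (\<lambda>h. min 1 ((norm h)\<^sup>2) * k h)"
    and meas[measurable]: "k \<in> borel_measurable borel" and nn: "\<And>h. 0 \<le> k h"
    and pos: "\<And>h. h \<noteq> 0 \<Longrightarrow> 0 < k h"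
    and int': "\<And>x. integrable lborel (\<lambda>h. min 1 ((norm h)\<^sup>2) * kx x h)"
    and meas': "\<And>x. kx x \<in> borel_measurable borel" and nn': "\<And>x h. 0 \<le> kx x h"
    and cmp: "\<And>x h. k h \<le> c * kx x h" "\<And>x h. kx x h \<le> c * k h" and c: "0 < c"
    and scale: "\<And>h t. 1 \<le> t \<Longrightarrow> k (inverse t *\<^sub>R h) \<le> D * t powr (real DIM('a) + \<gamma>) * k h"
    and D: "0 < D" and \<gamma>: "\<gamma> < 2"
    and doubling: "\<And>h h'. norm h \<le> 2 * norm h' \<Longrightarrow> norm h' \<le> 2 * norm h \<Longrightarrow> k h \<le> E * k h'"
    and E: "0 < E"
    and cont: "continuous_on UNIV u" and B: "\<And>z. \<bar>u z\<bar> \<le> B"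
    and intD: "\<And>x. integrable lborel (\<lambda>h. (u (x + h) + u (x - h) - 2 * u x) * kx x h)"
    and zero: "\<And>x. (\<integral>h. (u (x + h) + u (x - h) - 2 * u x) * kx x h \<partial>lborel) = 0"
  shows "u constant_on UNIV"
proof -
  have [measurable]: "u \<in> borel_measurable borel" using cont by (rule borel_measurable_continuous_onI)
  obtain C where C: "0 < C" and J_le: "\<And>R. 0 < R \<Longrightarrow>
    (\<integral>h. min 1 ((norm h / R)\<^sup>2) * k h \<partial>lborel) \<le> C * (\<integral>h. indicator {h. 6 * R \<le> norm h} h * k h \<partial>lborel)"
    \<comment> \<open>The near-extremal points will be at distance at most 3R, so beyond 6R the
      translation between them changes |h| by a factor of at most 2 and \<open>doubling\<close>
      applies.\<close>
    using truncated_moment_le_tail[OF int meas nn scale D \<gamma>, of 6] by auto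
  define M m where "M = (SUP z. u z)" and "m = (INF z. u z)"
  have bdd: "bdd_above (range u)" "bdd_below (range u)"
    using B by (auto intro!: bdd_aboveI2[of _ _ B] bdd_belowI2[of _ "- B"] simp: abs_le_iff minus_le_iff)
  have M: "u z \<le> M" and m: "m \<le> u z" for z
    unfolding M_def m_def using bdd by (auto intro: cSUP_upper cINF_lower)
  have osc: "M - m \<le> (4 * c\<^sup>2 * C * (1 + E)) * \<epsilon>" if \<epsilon>: "0 < \<epsilon>" for \<epsilon>
  proof -
    obtain x0 where x0: "M - \<epsilon> < u x0"
      using less_cSUP_iff[OF _ bdd(1), of "M - \<epsilon>"] \<epsilon> by (auto simp: M_def)
    obtain y0 where y0: "u y0 < m + \<epsilon>"
      using cINF_less_iff[OF _ bdd(2), of "m + \<epsilon>"] \<epsilon> by (auto simp: m_def)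
    \<comment> \<open>The summand 1 keeps R positive when \<open>x0 = y0\<close>.\<close>
    define R where "R = norm (x0 - y0) + 1"
    have R: "0 < R" "norm (x0 - y0) \<le> R" by (simp_all add: R_def add_nonneg_pos)
    define J where "J = (\<integral>h. min 1 ((norm h / R)\<^sup>2) * k h \<partial>lborel)"
    define N where "N = (\<integral>h. indicator {h. 6 * R \<le> norm h} h * k h \<partial>lborel)"
    obtain x where x: "norm (x - x0) \<le> R" "M - \<epsilon> \<le> u x"
      "\<And>h. u (x + h) + u (x - h) - 2 * u x \<le> 4 * \<epsilon> * min 1 ((norm h / R)\<^sup>2)"
      using near_maximum_point[OF cont M x0 \<epsilon> R(1)] by blast
    have Tx: "(\<integral>h. indicator {h. R \<le> norm h} h * (M - u (x + h)) * k h \<partial>lborel) \<le> 4 * \<epsilon> * c\<^sup>2 * J"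
      unfolding J_def
      by (rule tail_deviation_le[where k' = "kx x", OF int meas nn int' meas' nn' cmp c _ B M x(2) R(1) \<epsilon> x(3) intD zero])
        measurable
    have cont': "continuous_on UNIV (\<lambda>z. - u z)" using cont by (rule continuous_on_minus)
    have M': "- u z \<le> - m" for z using m by simp
    have y0': "- m - \<epsilon> < - u y0" using y0 by simp
    obtain y where y: "norm (y - y0) \<le> R" "- m - \<epsilon> \<le> - u y"
      "\<And>h. - u (y + h) + - u (y - h) - 2 * - u y \<le> 4 * \<epsilon> * min 1 ((norm h / R)\<^sup>2)"
      using near_maximum_point[OF cont' M' y0' \<epsilon> R(1)] by blast
    have neg: "(- u (y + h) + - u (y - h) - 2 * - u y) * kx y h =
        - ((u (y + h) + u (y - h) - 2 * u y) * kx y h)" for h by (simp add: algebra_simps)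
    have intD': "integrable lborel (\<lambda>h. (- u (y + h) + - u (y - h) - 2 * - u y) * kx y h)"
      unfolding neg using intD[of y] by (rule Bochner_Integration.integrable_minus)
    have zero': "(\<integral>h. (- u (y + h) + - u (y - h) - 2 * - u y) * kx y h \<partial>lborel) = 0"
      unfolding neg using zero[of y] by simp
    have B': "\<bar>- u z\<bar> \<le> B" for z using B by simp
    have Ty: "(\<integral>h. indicator {h. R \<le> norm h} h * (- m - - u (y + h)) * k h \<partial>lborel) \<le> 4 * \<epsilon> * c\<^sup>2 * J"
      unfolding J_def
      by (rule tail_deviation_le[where k' = "kx y", OF int meas nn int' meas' nn' cmp c _ B' M' y(2) R(1) \<epsilon> y(3) intD' zero'])
        measurable
    have xy: "norm (x - y) \<le> 3 * R"
    proof -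
      have "x - y = (x - x0) + (x0 - y0) - (y - y0)" by simp
      then have "norm (x - y) \<le> norm (x - x0) + norm (x0 - y0) + norm (y - y0)"
        using norm_triangle_ineq4[of "x - x0 + (x0 - y0)" "y - y0"] norm_triangle_ineq[of "x - x0" "x0 - y0"]
        by simp
      then show ?thesis using x(1) y(1) R by linarith
    qed
    have R6: "0 < 6 * R" using R by simp
    have bM: "\<bar>M - u z\<bar> \<le> \<bar>M\<bar> + B" and bm: "\<bar>u z - m\<bar> \<le> \<bar>m\<bar> + B" for z using B[of z] by linarith+
    have i1: "integrable lborel (\<lambda>h. indicator {h. r \<le> norm h} h * (M - u (x + h)) * k h)" if "0 < r" for r
      by (rule integrable_tail[OF int meas nn that _ bM]) measurable
    have i2: "integrable lborel (\<lambda>h. indicator {h. r \<le> norm h} h * (u (z + h) - m) * k h)" if "0 < r" for r z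
      by (rule integrable_tail[OF int meas nn that _ bm]) measurable
    \<comment> \<open>Writing M - m = (M - u(x + h)) + (u(x + h) - m) puts both deviations at the
      same point; the second is recentred at \<open>y\<close> below.\<close>
    have "(M - m) * N = (\<integral>h. (M - m) * (indicator {h. 6 * R \<le> norm h} h * k h) \<partial>lborel)"
      unfolding N_def by simp
    also have "\<dots> = (\<integral>h. indicator {h. 6 * R \<le> norm h} h * (M - u (x + h)) * k h +
        indicator {h. 6 * R \<le> norm h} h * (u (x + h) - m) * k h \<partial>lborel)"
      by (intro Bochner_Integration.integral_cong) (auto simp: algebra_simps)
    also have "\<dots> = (\<integral>h. indicator {h. 6 * R \<le> norm h} h * (M - u (x + h)) * k h \<partial>lborel) +
        (\<integral>h. indicator {h. 6 * R \<le> norm h} h * (u (x + h) - m) * k h \<partial>lborel)"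
      by (rule Bochner_Integration.integral_add[OF i1[OF R6] i2[OF R6]])
    also have "(\<integral>h. indicator {h. 6 * R \<le> norm h} h * (M - u (x + h)) * k h \<partial>lborel) \<le>
        (\<integral>h. indicator {h. R \<le> norm h} h * (M - u (x + h)) * k h \<partial>lborel)"
      by (rule integral_mono[OF i1[OF R6] i1[OF R(1)]])
        (use M R nn in \<open>auto simp: indicator_def\<close>)
    also note Tx
    also have "(\<integral>h. indicator {h. 6 * R \<le> norm h} h * (u (x + h) - m) * k h \<partial>lborel) =
        (\<integral>h. indicator {h. 6 * R \<le> norm h} (y - x + h) * (u (y + h) - m) * k (y - x + h) \<partial>lborel)"
      by (subst integral_lborel_affine[of _ 1 "y - x"]) (auto simp: algebra_simps)
    also have "\<dots> \<le> (\<integral>h. E * (indicator {h. R \<le> norm h} h * (u (y + h) - m) * k h) \<partial>lborel)"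
    proof (rule integral_mono')
      fix h
      show "0 \<le> E * (indicator {h. R \<le> norm h} h * (u (y + h) - m) * k h)"
        using E m nn by simp
      show "indicator {h. 6 * R \<le> norm h} (y - x + h) * (u (y + h) - m) * k (y - x + h) \<le>
        E * (indicator {h. R \<le> norm h} h * (u (y + h) - m) * k h)"
      proof (cases "6 * R \<le> norm (y - x + h)")
        case True
        have "norm (y - x + h) \<le> norm (x - y) + norm h"
          using norm_triangle_ineq[of "y - x" h] by (simp add: norm_minus_commute)
        moreover have "norm h \<le> norm (y - x + h) + norm (x - y)"
          using norm_triangle_ineq[of "y - x + h" "x - y"] by simp
        ultimately have h: "R \<le> norm h" "norm (y - x + h) \<le> 2 * norm h" "norm h \<le> 2 * norm (y - x + h)"
          using xy True R by linarith+
        have "(u (y + h) - m) * k (y - x + h) \<le> (u (y + h) - m) * (E * k h)"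
          using m doubling[OF h(2,3)] by (intro mult_left_mono) auto
        then show ?thesis using True h(1) by (simp add: mult_ac)
      qed (use E m nn in simp)
    qed (intro integrable_mult_right i2 R)
    also have "\<dots> = E * (\<integral>h. indicator {h. R \<le> norm h} h * (- m - - u (y + h)) * k h \<partial>lborel)"
      by (subst integral_mult_right_zero) simp
    also have "\<dots> \<le> E * (4 * \<epsilon> * c\<^sup>2 * J)" using Ty E by (intro mult_left_mono) auto
    also have "4 * \<epsilon> * c\<^sup>2 * J + E * (4 * \<epsilon> * c\<^sup>2 * J) = 4 * \<epsilon> * c\<^sup>2 * (1 + E) * J" by (simp add: algebra_simps)
    also have "\<dots> \<le> 4 * \<epsilon> * c\<^sup>2 * (1 + E) * (C * N)"
      using J_le[OF R(1)] \<epsilon> c E unfolding J_def N_def by (intro mult_left_mono) auto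
    finally have "(M - m) * N \<le> (4 * c\<^sup>2 * C * (1 + E)) * \<epsilon> * N" by (simp add: mult_ac)
    \<comment> \<open>Needed to cancel N: a positive kernel cannot have zero integral over a region
      containing a nonempty open set.\<close>
    moreover have "0 < N"
    proof -
      have iN: "integrable lborel (\<lambda>h. indicator {h. 6 * R \<le> norm h} h * k h)"
        using integrable_tail[OF int meas nn R6, of "\<lambda>_. 1" 1] by simp
      have "0 \<le> N" unfolding N_def using nn by (intro integral_nonneg_AE) auto
      moreover have "N \<noteq> 0"
      proof
        assume "N = 0"
        then have "AE h in lborel. indicator {h. 6 * R \<le> norm h} h * k h = 0"
          unfolding N_def using iN nn by (subst (asm) integral_nonneg_eq_0_iff_AE) auto
        then have ae: "AE h in lborel. h \<notin> {h::'a. 6 * R < norm h}"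
        proof eventually_elim
          case (elim h)
          have "k h = 0" "h \<noteq> 0" if "6 * R < norm h" using elim that R by auto
          then show ?case using pos[of h] by auto
        qed
        have op: "open {h::'a. 6 * R < norm h}" by (intro open_Collect_less continuous_intros)
        obtain b :: 'a where b: "b \<in> Basis" by (meson nonempty_Basis all_not_in_conv)
        have "((6 * R + 1) *\<^sub>R b) \<in> {h. 6 * R < norm h}" using b R by simp
        then have "{h::'a. 6 * R < norm h} \<noteq> {}" by blast
        moreover have "{h::'a. 6 * R < norm h} \<in> null_sets lborel"
          using ae op by (subst AE_iff_null_sets) auto
        then have "negligible {h::'a. 6 * R < norm h}"
          unfolding negligible_iff_null_sets by (rule null_sets_completionI)
        ultimately show False using op open_not_negligible by blast
      qed
      ultimately show ?thesis by simp
    qed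
    ultimately show ?thesis by simp
  qed
  have "M - m \<le> 0"
  proof (rule field_le_epsilon)
    fix e :: real assume e: "0 < e"
    define A where "A = 4 * c\<^sup>2 * C * (1 + E)"
    have "0 < A" using c C E by (simp add: A_def)
    then show "M - m \<le> 0 + e" using osc[of "e / A"] e unfolding A_def[symmetric] by simp
  qed
  then have "u z = M" for z using M[of z] m[of z] by linarith
  then show ?thesis unfolding constant_on_def by blast
qed

section \<open>Deriving the kernel hypotheses from the scaling of \<open>l\<close>\<close>

theorem corollary4:
  fixes \<kappa> K\<^sub>0 c\<^sub>L c\<^sub>U \<gamma> :: real
    and l :: "real \<Rightarrow> real"
    and K :: "real ^ 'd \<Rightarrow> real ^ 'd \<Rightarrow> real"
    and u :: "real ^ 'd \<Rightarrow> real"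
  assumes constants: "\<kappa> \<ge> 1" "K\<^sub>0 \<ge> 1" "0 < c\<^sub>L" "c\<^sub>L < 1" "c\<^sub>U \<ge> 1" "0 < \<gamma>" "\<gamma> < 2"
    and l_measurable: "l \<in> borel_measurable (lebesgue_on {0<..})"
    and l_pos: "\<And>s. s > 0 \<Longrightarrow> l s > 0"
    and l_not_integrable: "(\<integral>\<^sup>+ s. ennreal (l s / s) \<partial>lebesgue_on {0<..}) = \<infinity>"
    and l_tail: "\<And>r. r > 0 \<Longrightarrow> (\<integral>\<^sup>+ s. ennreal (l s / s) \<partial>lebesgue_on {r<..}) < \<infinity>"
    and l_lower_scaling: "\<And>r t. r > 0 \<Longrightarrow> t \<ge> 1 \<Longrightarrow> l (r * t) / l r \<ge> c\<^sub>L * t powr (- \<gamma>)"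
    and l_upper_scaling: "\<And>r t. r > 0 \<Longrightarrow> t \<ge> 1 \<Longrightarrow> l (r * t) / l r \<le> c\<^sub>U * t ^ CARD('d)"
    and K_measurable:
      "(\<lambda>(x, h). K x h) \<in> borel_measurable (restrict_space borel (UNIV \<times> - {0}))"
    and K_nonneg: "\<And>x h. h \<noteq> 0 \<Longrightarrow> K x h \<ge> 0"
    and K_symmetric: "\<And>x h. h \<noteq> 0 \<Longrightarrow> K x h = K x (- h)"
    and K_lower: "\<And>x h. h \<noteq> 0 \<Longrightarrow> inverse \<kappa> * (l (norm h) / norm h ^ CARD('d)) \<le> K x h"
    and K_upper: "\<And>x h. h \<noteq> 0 \<Longrightarrow> K x h \<le> \<kappa> * (l (norm h) / norm h ^ CARD('d))"
    and K_levy: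
      "(SUP x. \<integral>\<^sup>+ h\<in>-{0}. ennreal (min 1 ((norm h)\<^sup>2) * K x h) \<partial>lborel) \<le> ennreal K\<^sub>0"
    and u_Cb2: "u \<in> Cb2"
    and u_harmonic: "\<And>x. nonlocal_op K u x = 0"
  shows "u constant_on UNIV"
proof -
  define kx where "kx x h = indicator (- {0}) h * K x h" for x h
  \<comment> \<open>The common radial profile of all the kernels. It is used for pointwise
    comparison only: the reference kernel is \<open>kx 0\<close>, whose Borel measurability and Levy
    bound come directly from K, whereas \<open>l\<close> is merely Lebesgue measurable.\<close>
  define \<nu> where "\<nu> s = l s / s ^ CARD('d)" for s
  have \<nu>_pos: "0 < \<nu> s" if "0 < s" for s using l_pos[OF that] that by (simp add: \<nu>_def)
  have \<kappa>: "0 < \<kappa>" using constants by simp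
  have kx_0: "kx x 0 = 0" for x by (simp add: kx_def)
  have kx_lower: "\<nu> (norm h) \<le> \<kappa> * kx x h" and kx_upper: "kx x h \<le> \<kappa> * \<nu> (norm h)" if "h \<noteq> 0" for x h
    using K_lower[OF that, of x] K_upper[OF that, of x] that \<kappa> by (simp_all add: kx_def \<nu>_def field_simps)
  have nn: "0 \<le> kx x h" for x h using K_nonneg by (simp add: kx_def indicator_def)
  have sym: "kx x (- h) = kx x h" for x h using K_symmetric[of h x] by (cases "h = 0") (simp_all add: kx_def)
  have meas[measurable]: "kx x \<in> borel_measurable borel" for x
  proof -
    have "(\<lambda>h. (x, h)) \<in> measurable (restrict_space borel (- {0})) (restrict_space borel (UNIV \<times> - {0}))"
      by (intro measurable_restrict_space3) (auto intro!: borel_measurable_continuous_onI continuous_intros)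
    from measurable_compose[OF this K_measurable]
    have "K x \<in> borel_measurable (restrict_space borel (- {0}))" by simp
    then show ?thesis unfolding kx_def
      by (subst (asm) borel_measurable_restrict_space_iff) auto
  qed
  have int: "integrable lborel (\<lambda>h. min 1 ((norm h)\<^sup>2) * kx x h)" for x
  proof (rule integrableI_bounded)
    have "(\<integral>\<^sup>+ h. ennreal (norm (min 1 ((norm h)\<^sup>2) * kx x h)) \<partial>lborel) =
        (\<integral>\<^sup>+ h\<in>-{0}. ennreal (min 1 ((norm h)\<^sup>2) * K x h) \<partial>lborel)"
      using K_nonneg by (intro nn_integral_cong) (auto simp: kx_def indicator_def)
    also have "\<dots> \<le> (SUP x. \<integral>\<^sup>+ h\<in>-{0}. ennreal (min 1 ((norm h)\<^sup>2) * K x h) \<partial>lborel)"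
      by (intro SUP_upper) simp
    also have "\<dots> \<le> ennreal K\<^sub>0" by (rule K_levy)
    also have "\<dots> < \<infinity>" by simp
    finally show "(\<integral>\<^sup>+ h. ennreal (norm (min 1 ((norm h)\<^sup>2) * kx x h)) \<partial>lborel) < \<infinity>" .
  qed measurable
  \<comment> \<open>Passing through \<open>\<nu>\<close> costs one factor \<open>\<kappa>\<close> on
    each side.\<close>
  have cmp: "kx x h \<le> \<kappa>\<^sup>2 * kx y h" for x y h
  proof (cases "h = 0")
    case False
    have "kx x h \<le> \<kappa> * \<nu> (norm h)" by (rule kx_upper[OF False])
    also have "\<dots> \<le> \<kappa> * (\<kappa> * kx y h)" using kx_lower[OF False] \<kappa> by (intro mult_left_mono) auto
    finally show ?thesis by (simp add: power2_eq_square mult_ac)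
  qed (simp add: kx_0)
  have kx_compare: "kx x h \<le> \<kappa>\<^sup>2 * A * kx x h'"
    if "h \<noteq> 0" "h' \<noteq> 0" "\<nu> (norm h) \<le> A * \<nu> (norm h')" "0 \<le> A" for x h h' A
  proof -
    have "kx x h \<le> \<kappa> * \<nu> (norm h)" by (rule kx_upper[OF that(1)])
    also have "\<dots> \<le> \<kappa> * (A * \<nu> (norm h'))" using that(3) \<kappa> by (intro mult_left_mono) auto
    also have "\<dots> \<le> \<kappa> * (A * (\<kappa> * kx x h'))"
      using kx_lower[OF that(2), of x] that(4) \<kappa> by (intro mult_left_mono) auto
    finally show ?thesis by (simp add: power2_eq_square mult_ac)
  qed
  have \<nu>_lower: "\<nu> (r / t) \<le> inverse c\<^sub>L * t powr (real CARD('d) + \<gamma>) * \<nu> r" if "0 < r" "1 \<le> t" for r t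
  proof -
    have "c\<^sub>L * t powr (- \<gamma>) * l (r / t) \<le> l r"
      using l_lower_scaling[of "r / t" t] l_pos[of "r / t"] that by (simp add: field_simps)
    then have "l (r / t) \<le> inverse c\<^sub>L * t powr \<gamma> * l r"
      using constants that by (simp add: powr_minus field_simps)
    then have "l (r / t) * t ^ CARD('d) / r ^ CARD('d) \<le>
        (inverse c\<^sub>L * t powr \<gamma> * l r) * t ^ CARD('d) / r ^ CARD('d)"
      using that by (intro divide_right_mono mult_right_mono) auto
    then show ?thesis using that by (simp add: \<nu>_def powr_add powr_realpow power_divide mult_ac)
  qed
  \<comment> \<open>The growth t^d allowed for \<open>l\<close> is exactly offset by the denominator
    of \<open>\<nu>\<close>, so \<open>\<nu>\<close> is decreasing up to the factor
    \<open>c\<^sub>U\<close>.\<close>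
  have \<nu>_upper: "\<nu> (r * t) \<le> c\<^sub>U * \<nu> r" if "0 < r" "1 \<le> t" for r t
  proof -
    have "l (r * t) \<le> c\<^sub>U * t ^ CARD('d) * l r"
      using l_upper_scaling[of r t] l_pos[of r] that by (simp add: field_simps)
    then have "l (r * t) / (r * t) ^ CARD('d) \<le> c\<^sub>U * t ^ CARD('d) * l r / (r * t) ^ CARD('d)"
      using that by (intro divide_right_mono) auto
    then show ?thesis using that by (simp add: \<nu>_def power_mult_distrib)
  qed
  \<comment> \<open>Covers both orders of two norms within a factor 2: the first summand when |h| <=
    |h'|, the second when |h| > |h'|.\<close>
  define F where "F = inverse c\<^sub>L * 2 powr (real CARD('d) + \<gamma>) + c\<^sub>U"
  have F: "0 < F" "inverse c\<^sub>L * 2 powr (real CARD('d) + \<gamma>) \<le> F" "c\<^sub>U \<le> F"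
    using constants by (simp_all add: F_def add_pos_pos)
  obtain B where B: "\<And>z. \<bar>u z\<bar> \<le> B" using Cb2_taylor[OF u_Cb2] by metis
  show ?thesis
  proof (rule liouville_comparable_kernels[where k = "kx 0" and kx = kx and c = "\<kappa>\<^sup>2"
        and D = "\<kappa>\<^sup>2 * inverse c\<^sub>L" and E = "\<kappa>\<^sup>2 * F", OF int meas nn _ int meas nn cmp cmp _ _ _ _ _ _ _ B])
    show "0 < kx 0 h" if "h \<noteq> 0" for h
      using kx_lower[OF that, of 0] \<nu>_pos[of "norm h"] that \<kappa>
      by (auto intro: zero_less_mult_pos[of \<kappa>])
    show "kx 0 (inverse t *\<^sub>R h) \<le> \<kappa>\<^sup>2 * inverse c\<^sub>L * t powr (real DIM(real ^ 'd) + \<gamma>) * kx 0 h"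
      if t: "1 \<le> t" for t and h :: "real ^ 'd"
    proof (cases "h = 0")
      case False
      have "\<nu> (norm (inverse t *\<^sub>R h)) \<le> inverse c\<^sub>L * t powr (real CARD('d) + \<gamma>) * \<nu> (norm h)"
        using \<nu>_lower[of "norm h" t] False t by (simp add: field_simps)
      from kx_compare[OF _ False this, of 0] False t constants show ?thesis by (simp add: mult_ac)
    qed (simp add: kx_0)
    show "kx 0 h \<le> \<kappa>\<^sup>2 * F * kx 0 h'"
      if hh: "norm h \<le> 2 * norm h'" "norm h' \<le> 2 * norm h" for h h' :: "real ^ 'd"
    proof (cases "h = 0")
      case False
      then have h': "h' \<noteq> 0" using hh by auto
      have n: "0 < norm h" "0 < norm h'" using False h' by auto
      have "\<nu> (norm h) \<le> F * \<nu> (norm h')"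
      proof (cases "norm h \<le> norm h'")
        case True
        define t where "t = norm h' / norm h"
        have t: "1 \<le> t" "t \<le> 2" "norm h' / t = norm h" using True hh n by (auto simp: t_def field_simps)
        have "\<nu> (norm h) \<le> inverse c\<^sub>L * t powr (real CARD('d) + \<gamma>) * \<nu> (norm h')"
          using \<nu>_lower[OF n(2) t(1)] t(3) by simp
        also have "\<dots> \<le> inverse c\<^sub>L * 2 powr (real CARD('d) + \<gamma>) * \<nu> (norm h')"
          using t constants \<nu>_pos[OF n(2)] by (intro mult_right_mono mult_left_mono powr_mono2) auto
        also have "\<dots> \<le> F * \<nu> (norm h')" using F \<nu>_pos[OF n(2)] by (intro mult_right_mono) auto
        finally show ?thesis .
      next
        case *: False
        have "\<nu> (norm h) \<le> c\<^sub>U * \<nu> (norm h')"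
          using \<nu>_upper[OF n(2), of "norm h / norm h'"] * n by simp
        also have "\<dots> \<le> F * \<nu> (norm h')" using F \<nu>_pos[OF n(2)] by (intro mult_right_mono) auto
        finally show ?thesis .
      qed
      then show ?thesis using kx_compare[OF False h'] F by simp
    qed (use nn F in \<open>simp add: kx_0\<close>)
    show "continuous_on UNIV u" using u_Cb2 by (simp add: Cb2_def)
    fix x
    note second = nonlocal_op_second_difference[OF u_Cb2, of K x, folded kx_def, OF int meas nn sym]
    show "integrable lborel (\<lambda>h. (u (x + h) + u (x - h) - 2 * u x) * kx x h)" by (rule second(1))
    show "(\<integral>h. (u (x + h) + u (x - h) - 2 * u x) * kx x h \<partial>lborel) = 0"
      using second(2) u_harmonic by simp
  qed (use constants F \<kappa> in auto)
qed

end
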